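(* Let $1\le p<\infty$ and let $X$ be a Banach space. Suppose there exist a Banach space $Z$ and a dual $p$-persistent operator $T\in B(Z,X)$ such that $T^*\in\Pi_p(X^*,Z^* )$. Then $\mathrm{FBL}^{(p)}[X]$ fails the $\lambda$-Fatou property, for every $\lambda>0$, and $\overline{I}_{w^*}^{p}[X]$ is not monotonically bounded.
   Context: All Banach spaces are real. $B(Z,X)$ is the space of bounded linear operators; $\Pi_p$ is the ideal of $p$-summing operators with norm $\pi_p$, and $\pi_p(S)=\infty$ if $S$ is not $p$-summing. Let $1/p+1/p'=1$. For $z_1,\dots,z_n$ in a Banach space, $\|(z_i)_{i=1}^n\|_{p,\mathrm{weak}}=\sup\{\|\sum_i\alpha_i z_i\| : \|(\alpha_i)_i\|_{\ell_{p'}}\le 1\}$. For a Banach space $X$, $H_{w^*}[X]$ is the vector lattice (pointwise operations and order) of positively homogeneous functions $f:X^*\to\mathbb R$ that are weak$^*$-continuous on bounded sets. For $f\in H_{w^*}[X]$, $\|f\|_p$ is the infimum of all $C\ge 0$ such that $(\sum_{i=1}^n|f(x_i^* )|^p)^{1/p}\le C\|(x_i^* )_{i=1}^n\|_{p,\mathrm{weak}}$ for all $n$ and all $x_1^*,\dots,x_n^*\in X^*$. $H_{w^*}^p[X]=\{f\in H_{w^*}[X]:\|f\|_p<\infty\}$, normed by $\|\cdot\|_p$. For $x\in X$, $\delta_x(x^* )=\langle x^*,x\rangle$. $\mathrm{FVL}[X]$ is the vector sublattice of $H_{w^*}[X]$ generated by $\{\delta_x:x\in X\}$; $\mathrm{FBL}^{(p)}[X]$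 is the closure of $\mathrm{FVL}[X]$ in $H_{w^*}^p[X]$; $I_{w^*}[X]$ is the (order) ideal of $H_{w^*}[X]$ generated by $\{\delta_x:x\in X\}$; $\overline{I}_{w^*}^p[X]$ is the closure of $I_{w^*}[X]$ in $H_{w^*}^p[X]$. $T\in B(Z,X)$ is dual $p$-persistent relative to a dense set $X_0\subset X$ if there is $c>0$ such that $\pi_p\big(T^*|_{\bigcap_i x_i^\perp}\big)>c$ for all finite collections $x_1,\dots,x_n\in X_0$, where $x_i^\perp=\{x^*\in X^*:\langle x^*,x_i\rangle=0\}$. $T$ is dual $p$-persistent if this holds for some dense $X_0\subset X$. A Banach lattice $Z$ has the $\lambda$-Fatou property if for every upward directed set $\mathcal S\subset Z_+$ having a supremum $z_0$ in $Z$, one has $\|z_0\|\le\lambda\sup_{z\in\mathcal S}\|z\|$. $Z$ is monotonically bounded if every norm-bounded increasing net in $Z_+$ has an upper bound in $Z$. *)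

theory Defs
  imports "HOL-Analysis.Analysis"
begin

type_synonym 'a dual = "'a \<Rightarrow>\<^sub>L real"

(* For scalar-valued operators, the strong operator topology is pointwise convergence on X,
   i.e. the weak* topology of the dual. *)
abbreviation weak_star :: "'a::real_normed_vector dual topology" where
  "weak_star \<equiv> strong_operator_topology"

definition conj_exp :: "real \<Rightarrow> ereal" where
  "conj_exp p = (if p = 1 then \<infinity> else ereal (p / (p - 1)))"

(* Finite sequences (z_1, ..., z_n) are represented by functions on nat restricted to {..<n}. *)
definition ell_norm :: "ereal \<Rightarrow> nat \<Rightarrow> (nat \<Rightarrow> real) \<Rightarrow> real" where
  "ell_norm q n a =
     (if q = \<infinity> then Max (insert 0 ((\<lambda>i. \<bar>a i\<bar>) ` {..<n}))
      else (\<Sum>i<n. \<bar>a i\<bar> powr real_of_ereal q) powr (1 / real_of_ereal q))"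

definition weak_norm :: "real \<Rightarrow> nat \<Rightarrow> (nat \<Rightarrow> 'a::real_normed_vector) \<Rightarrow> real" where
  "weak_norm p n z =
     (SUP a\<in>{a. ell_norm (conj_exp p) n a \<le> 1}. norm (\<Sum>i<n. a i *\<^sub>R z i))"

(* The p-summing norm of the restriction of S to the subspace W. The weak norm of vectors of W
   is the same in W as in the ambient space. In ennreal the infimum of the empty set is infinity. *)
definition pi_norm_on ::
  "real \<Rightarrow> 'a::real_normed_vector set \<Rightarrow> ('a \<Rightarrow>\<^sub>L 'b::real_normed_vector) \<Rightarrow> ennreal" where
  "pi_norm_on p W S =
     (INF C\<in>{C. 0 \<le> C \<and> (\<forall>n z. (\<forall>i<n. z i \<in> W) \<longrightarrow>
         (\<Sum>i<n. norm (blinfun_apply S (z i)) powr p) powr (1 / p) \<le> C * weak_norm p n z)}.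
       ennreal C)"

definition p_summing ::
  "real \<Rightarrow> ('a::real_normed_vector \<Rightarrow>\<^sub>L 'b::real_normed_vector) \<Rightarrow> bool" where
  "p_summing p S \<longleftrightarrow> pi_norm_on p UNIV S < \<infinity>"

definition adjoint_op ::
  "('z::real_normed_vector \<Rightarrow>\<^sub>L 'x::real_normed_vector) \<Rightarrow> ('x dual \<Rightarrow>\<^sub>L 'z dual)" where
  "adjoint_op T = Blinfun (\<lambda>\<phi>. \<phi> o\<^sub>L T)"

lemma adjoint_op_apply: "blinfun_apply (adjoint_op T) \<phi> = \<phi> o\<^sub>L T"
  unfolding adjoint_op_def
  by (simp add: bounded_linear_Blinfun_apply
      bounded_bilinear.bounded_linear_left[OF bounded_bilinear_blinfun_compose])

definition annih :: "'x::real_normed_vector \<Rightarrow> 'x dual set" where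
  "annih x = {\<phi>. blinfun_apply \<phi> x = 0}"

definition dual_persistent_rel ::
  "real \<Rightarrow> 'x set \<Rightarrow> ('z::real_normed_vector \<Rightarrow>\<^sub>L 'x::real_normed_vector) \<Rightarrow> bool" where
  "dual_persistent_rel p X0 T \<longleftrightarrow>
     (\<exists>c>0. \<forall>F. finite F \<and> F \<subseteq> X0 \<longrightarrow>
        ennreal c < pi_norm_on p (\<Inter>x\<in>F. annih x) (adjoint_op T))"

definition dual_persistent ::
  "real \<Rightarrow> ('z::real_normed_vector \<Rightarrow>\<^sub>L 'x::real_normed_vector) \<Rightarrow> bool" where
  "dual_persistent p T \<longleftrightarrow> (\<exists>X0. closure X0 = UNIV \<and> dual_persistent_rel p X0 T)"

definition Hw :: "('x::real_normed_vector dual \<Rightarrow> real) set" where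
  "Hw = {f. (\<forall>c \<phi>. 0 \<le> c \<longrightarrow> f (c *\<^sub>R \<phi>) = c * f \<phi>) \<and>
            (\<forall>B. bounded B \<longrightarrow> continuous_map (subtopology weak_star B) euclideanreal f)}"

definition Hnorm :: "real \<Rightarrow> ('x::real_normed_vector dual \<Rightarrow> real) \<Rightarrow> ennreal" where
  "Hnorm p f =
     (INF C\<in>{C. 0 \<le> C \<and> (\<forall>n \<phi>.
         (\<Sum>i<n. \<bar>f (\<phi> i)\<bar> powr p) powr (1 / p) \<le> C * weak_norm p n \<phi>)}. ennreal C)"

definition Hwp :: "real \<Rightarrow> ('x::real_normed_vector dual \<Rightarrow> real) set" where
  "Hwp p = {f \<in> Hw. Hnorm p f < \<infinity>}"

definition Hwp_closure ::
  "real \<Rightarrow> ('x::real_normed_vector dual \<Rightarrow> real) set \<Rightarrow> ('x dual \<Rightarrow> real) set" where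
  "Hwp_closure p A =
     {f \<in> Hwp p. \<forall>\<epsilon>>0. \<exists>g\<in>A. Hnorm p (\<lambda>\<phi>. f \<phi> - g \<phi>) < ennreal \<epsilon>}"

definition delta :: "'x::real_normed_vector \<Rightarrow> 'x dual \<Rightarrow> real" where
  "delta x = (\<lambda>\<phi>. blinfun_apply \<phi> x)"

definition fun_subspace :: "('a \<Rightarrow> real) set \<Rightarrow> bool" where
  "fun_subspace S \<longleftrightarrow> (\<lambda>_. 0) \<in> S \<and> (\<forall>f\<in>S. \<forall>g\<in>S. (\<lambda>x. f x + g x) \<in> S) \<and>
     (\<forall>c. \<forall>f\<in>S. (\<lambda>x. c * f x) \<in> S)"

definition vector_sublattice_of :: "('a \<Rightarrow> real) set \<Rightarrow> ('a \<Rightarrow> real) set \<Rightarrow> bool" where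
  "vector_sublattice_of H S \<longleftrightarrow> S \<subseteq> H \<and> fun_subspace S \<and>
     (\<forall>f\<in>S. \<forall>g\<in>S. (\<lambda>x. max (f x) (g x)) \<in> S \<and> (\<lambda>x. min (f x) (g x)) \<in> S)"

definition order_ideal_of :: "('a \<Rightarrow> real) set \<Rightarrow> ('a \<Rightarrow> real) set \<Rightarrow> bool" where
  "order_ideal_of H S \<longleftrightarrow> S \<subseteq> H \<and> fun_subspace S \<and>
     (\<forall>f\<in>S. \<forall>g\<in>H. (\<forall>x. \<bar>g x\<bar> \<le> \<bar>f x\<bar>) \<longrightarrow> g \<in> S)"

definition FVL :: "('x::real_normed_vector dual \<Rightarrow> real) set" where
  "FVL = vector_sublattice_of Hw hull range delta"

definition FBL :: "real \<Rightarrow> ('x::real_normed_vector dual \<Rightarrow> real) set" where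
  "FBL p = Hwp_closure p FVL"

definition Iw :: "('x::real_normed_vector dual \<Rightarrow> real) set" where
  "Iw = order_ideal_of Hw hull range delta"

definition Iw_closure :: "real \<Rightarrow> ('x::real_normed_vector dual \<Rightarrow> real) set" where
  "Iw_closure p = Hwp_closure p Iw"

(* Banach lattices of functions are given by a carrier Z and a norm N; the order is the pointwise
   order on functions. *)

definition directed_preorder :: "'i set \<Rightarrow> ('i \<Rightarrow> 'i \<Rightarrow> bool) \<Rightarrow> bool" where
  "directed_preorder I le \<longleftrightarrow> I \<noteq> {} \<and> (\<forall>i\<in>I. le i i) \<and>
     (\<forall>i\<in>I. \<forall>j\<in>I. \<forall>k\<in>I. le i j \<and> le j k \<longrightarrow> le i k) \<and>
     (\<forall>i\<in>I. \<forall>j\<in>I. \<exists>k\<in>I. le i k \<and> le j k)"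

(* The supremum is taken in the ordered set Z; it need not be the pointwise supremum. *)
definition is_supremum_in :: "('a \<Rightarrow> real) set \<Rightarrow> ('a \<Rightarrow> real) set \<Rightarrow> ('a \<Rightarrow> real) \<Rightarrow> bool" where
  "is_supremum_in Z S z0 \<longleftrightarrow> z0 \<in> Z \<and> (\<forall>z\<in>S. z \<le> z0) \<and>
     (\<forall>u\<in>Z. (\<forall>z\<in>S. z \<le> u) \<longrightarrow> z0 \<le> u)"

definition positive_part :: "('a \<Rightarrow> real) set \<Rightarrow> ('a \<Rightarrow> real) set" where
  "positive_part Z = {z \<in> Z. \<forall>x. 0 \<le> z x}"

definition fatou_property ::
  "real \<Rightarrow> ('a \<Rightarrow> real) set \<Rightarrow> (('a \<Rightarrow> real) \<Rightarrow> ennreal) \<Rightarrow> bool" where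
  "fatou_property \<kappa> Z N \<longleftrightarrow>
     (\<forall>S z0. S \<subseteq> positive_part Z \<and> directed_preorder S (\<le>) \<and> is_supremum_in Z S z0 \<longrightarrow>
        N z0 \<le> ennreal \<kappa> * (SUP z\<in>S. N z))"

(* Nets are indexed by directed preordered sets (I, le) of elements of the ambient function type.
   This is no restriction: an increasing net can be replaced by its range, which is upward
   directed and indexes itself, without changing its upper bounds or its norm bounds. *)
definition monotonically_bounded ::
  "('a \<Rightarrow> real) set \<Rightarrow> (('a \<Rightarrow> real) \<Rightarrow> ennreal) \<Rightarrow> bool" where
  "monotonically_bounded Z N \<longleftrightarrow>
     (\<forall>(I :: ('a \<Rightarrow> real) set) le z.
        directed_preorder I le \<and> (\<forall>i\<in>I. z i \<in> positive_part Z) \<and>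
        (\<forall>i\<in>I. \<forall>j\<in>I. le i j \<longrightarrow> z i \<le> z j) \<and>
        (\<exists>C::real. \<forall>i\<in>I. N (z i) \<le> ennreal C) \<longrightarrow>
        (\<exists>u\<in>Z. \<forall>i\<in>I. z i \<le> u))"

end

theory Submission
  imports Defs
begin

text \<open>The function \<open>\<phi> \<mapsto> \<parallel>T\<^sup>* \<phi>\<parallel>\<close> is the pointwise supremum of the functions \<open>\<bar>\<delta>\<^bsub>T z\<^esub>\<bar>\<close> with
  \<open>\<parallel>z\<parallel> \<le> 1\<close>, and since \<open>T\<^sup>*\<close> is \<open>p\<close>-summing, every function below it has norm at most \<open>\<pi>\<^sub>p(T\<^sup>*)\<close>.
  Elements of the ideal vanish on the common annihilator of finitely many vectors, so elements of
  its closure have arbitrarily small \<open>p\<close>-norm on such annihilators (up to perturbing the vectors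
  into \<open>X\<^sub>0\<close>); persistence of \<open>T\<close> therefore forbids them from dominating \<open>\<parallel>T\<^sup>* \<phi>\<parallel>\<close>.
  For the Fatou property, truncate by \<open>N \<bar>\<delta>\<^sub>x\<bar>\<close> with \<open>x \<in> X\<^sub>0\<close>: the norms stay at most \<open>\<pi>\<^sub>p(T\<^sup>*)\<close>, but
  the supremum in \<open>FBL\<^bsup>(p)\<^esup>[X]\<close> is all of \<open>N \<bar>\<delta>\<^sub>x\<bar>\<close>, whose norm grows linearly in \<open>N\<close>.\<close>

subsection \<open>The spaces \<open>\<ell>\<^sub>p\<close> and weak norms\<close>

lemma ell_norm_ereal: "ell_norm (ereal p) n a = (\<Sum>i<n. \<bar>a i\<bar> powr p) powr (1 / p)"
  by (simp add: ell_norm_def)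

lemma ell_norm_nonneg: "0 \<le> ell_norm q n a"
  by (cases "q = \<infinity>") (auto simp: ell_norm_def intro!: Max_ge)

lemma ell_norm_powr:
  assumes "0 < p"
  shows "ell_norm (ereal p) n a powr p = (\<Sum>i<n. \<bar>a i\<bar> powr p)"
  using assms by (simp add: ell_norm_ereal powr_powr sum_nonneg)

lemma abs_le_ell_norm:
  assumes "0 < q" and "i < n"
  shows "\<bar>a i\<bar> \<le> ell_norm q n a"
proof (cases q)
  case (real r)
  then have r: "0 < r" using assms by simp
  have "\<bar>a i\<bar> powr r \<le> (\<Sum>i<n. \<bar>a i\<bar> powr r)"
    using assms(2) by (intro member_le_sum) auto
  also have "\<dots> = ell_norm q n a powr r"
    using ell_norm_powr[OF r] real by simp
  finally show ?thesis
    using powr_less_mono2[OF r ell_norm_nonneg, of q n a "\<bar>a i\<bar>"] by linarith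
next
  case PInf
  then show ?thesis using assms(2) by (auto simp: ell_norm_def intro!: Max_ge)
qed (use assms in auto)

lemma ell_norm_le_one_iff:
  assumes "0 < p"
  shows "ell_norm (ereal p) n a \<le> 1 \<longleftrightarrow> (\<Sum>i<n. \<bar>a i\<bar> powr p) \<le> 1"
proof
  assume "ell_norm (ereal p) n a \<le> 1"
  then have "ell_norm (ereal p) n a powr p \<le> 1"
    using assms ell_norm_nonneg[of "ereal p" n a] by (intro powr_le1) auto
  then show "(\<Sum>i<n. \<bar>a i\<bar> powr p) \<le> 1"
    by (simp add: ell_norm_powr[OF assms])
next
  assume "(\<Sum>i<n. \<bar>a i\<bar> powr p) \<le> 1"
  then show "ell_norm (ereal p) n a \<le> 1"
    unfolding ell_norm_ereal using assms by (intro powr_le1) (auto simp: sum_nonneg)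
qed

lemma ell_norm_mono:
  assumes "0 < p" and "\<And>i. i < n \<Longrightarrow> \<bar>a i\<bar> \<le> \<bar>b i\<bar>"
  shows "ell_norm (ereal p) n a \<le> ell_norm (ereal p) n b"
  unfolding ell_norm_ereal
  using assms by (intro powr_mono2 sum_mono sum_nonneg) auto

lemma ell_norm_scale:
  assumes "0 < p"
  shows "ell_norm (ereal p) n (\<lambda>i. c * a i) = \<bar>c\<bar> * ell_norm (ereal p) n a"
  using assms
  by (simp add: ell_norm_ereal abs_mult powr_mult sum_nonneg powr_powr flip: sum_distrib_left)

lemma conj_exp_pos: "1 \<le> p \<Longrightarrow> 0 < conj_exp p"
  by (simp add: conj_exp_def)

text \<open>For p > 1, Young's inequality is applied termwise to \<open>a i\<close> and
  \<open>b i / B\<close>, with \<open>B\<close> the p-norm of \<open>b\<close>, and summed. A zero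
  \<open>B\<close> cannot be normalised, but then all terms vanish. For p = 1 the conjugate exponent
  is infinite and \<open>\<bar>a i\<bar> \<le> 1\<close> suffices.\<close>

lemma holder_le_one:
  assumes "1 \<le> p" and "ell_norm (conj_exp p) n a \<le> 1"
  shows "\<bar>\<Sum>i<n. a i * b i\<bar> \<le> ell_norm (ereal p) n b"
proof (cases "p = 1")
  case True
  have "\<bar>a i\<bar> \<le> 1" if "i < n" for i
    using abs_le_ell_norm[OF conj_exp_pos[OF assms(1)] that, of a] assms(2) by linarith
  then have "\<bar>a i * b i\<bar> \<le> \<bar>b i\<bar>" if "i < n" for i
    using that by (simp add: abs_mult mult_left_le_one_le)
  then have "(\<Sum>i<n. \<bar>a i * b i\<bar>) \<le> (\<Sum>i<n. \<bar>b i\<bar>)"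
    by (intro sum_mono) auto
  also have "\<dots> = ell_norm (ereal p) n b"
    using True by (simp add: ell_norm_ereal sum_nonneg)
  finally show ?thesis
    by (rule order.trans[OF sum_abs])
next
  case False
  then have p: "1 < p" using assms(1) by simp
  define q where "q = p / (p - 1)"
  have q: "1 < q" and pq: "1/p + 1/q = 1"
    using p by (auto simp: q_def field_simps)
  have a: "(\<Sum>i<n. \<bar>a i\<bar> powr q) \<le> 1"
    using assms(2) False q ell_norm_le_one_iff[of q n a] by (simp add: conj_exp_def q_def)
  define B where "B = ell_norm (ereal p) n b"
  show ?thesis
  proof (cases "B = 0")
    case True
    have "b i = 0" if "i < n" for i
      using abs_le_ell_norm[of "ereal p" i n b] p that True by (simp add: B_def)
    then show ?thesis by (simp add: ell_norm_nonneg)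
  next
    case B: False
    then have "0 < B" using ell_norm_nonneg[of "ereal p" n b] by (simp add: B_def)
    have "(\<Sum>i<n. \<bar>a i\<bar> * (\<bar>b i\<bar> / B)) \<le> (\<Sum>i<n. \<bar>a i\<bar> powr q / q + (\<bar>b i\<bar> / B) powr p / p)"
      using p q pq \<open>0 < B\<close>
      by (intro sum_mono Youngs_inequality) auto
    also have "\<dots> = (\<Sum>i<n. \<bar>a i\<bar> powr q) / q + (\<Sum>i<n. \<bar>b i\<bar> powr p) / B powr p / p"
      using \<open>0 < B\<close> by (simp add: sum.distrib powr_divide flip: sum_divide_distrib)
    also have "(\<Sum>i<n. \<bar>b i\<bar> powr p) / B powr p = 1"
      using \<open>0 < B\<close> p by (simp add: B_def flip: ell_norm_powr)
    also have "(\<Sum>i<n. \<bar>a i\<bar> powr q) / q + 1 / p \<le> 1"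
      using a q pq divide_right_mono[OF a, of q] by simp
    finally have "(\<Sum>i<n. \<bar>a i\<bar> * \<bar>b i\<bar>) / B \<le> 1"
      by (simp add: sum_divide_distrib)
    then have "(\<Sum>i<n. \<bar>a i * b i\<bar>) \<le> B"
      using \<open>0 < B\<close> by (simp add: abs_mult)
    then show ?thesis
      unfolding B_def by (rule order.trans[OF sum_abs])
  qed
qed

text \<open>The extremal sequence is explicit: signs for p = 1, and otherwise
  \<open>sgn (b i) * \<bar>b i\<bar> powr (p - 1)\<close>, normalised. With
  \<open>holder_le_one\<close> this makes the p-norm a maximum of linear forms, the source of all
  duality arguments below.\<close>

lemma holder_attained:
  assumes "1 \<le> p"
  obtains a where "ell_norm (conj_exp p) n a \<le> 1" "(\<Sum>i<n. a i * b i) = ell_norm (ereal p) n b"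
proof (cases "p = 1")
  case True
  show ?thesis
  proof (rule that[of "\<lambda>i. sgn (b i)"])
    show "ell_norm (conj_exp p) n (\<lambda>i. sgn (b i)) \<le> 1"
      using True by (auto simp: conj_exp_def ell_norm_def abs_sgn_eq)
    show "(\<Sum>i<n. sgn (b i) * b i) = ell_norm (ereal p) n b"
      using True by (simp add: ell_norm_ereal sum_nonneg mult.commute flip: abs_sgn)
  qed
next
  case False
  then have p: "1 < p" using assms by simp
  define q where "q = p / (p - 1)"
  have q: "1 < q" and pq: "(p - 1) * q = p"
    using p by (auto simp: q_def field_simps)
  define B where "B = ell_norm (ereal p) n b"
  have B0: "0 \<le> B" by (simp add: B_def ell_norm_nonneg)
  have BP: "B powr p = (\<Sum>i<n. \<bar>b i\<bar> powr p)"
    using ell_norm_powr[of p n b] p by (simp add: B_def)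
  define a where "a i = sgn (b i) * \<bar>b i\<bar> powr (p - 1) / B powr (p - 1)" for i
  have ab: "\<bar>a i\<bar> powr q = \<bar>b i\<bar> powr p / B powr p" for i
    using pq q by (cases "b i = 0") (simp_all add: a_def abs_mult abs_sgn_eq powr_divide powr_powr)
  have abi: "a i * b i = \<bar>b i\<bar> powr p / B powr (p - 1)" for i
  proof -
    have "\<bar>b i\<bar> powr p = \<bar>b i\<bar> powr (p - 1) * \<bar>b i\<bar>"
      by (cases "b i = 0") (simp_all add: powr_diff)
    moreover have "a i * b i = \<bar>b i\<bar> powr (p - 1) * (b i * sgn (b i)) / B powr (p - 1)"
      by (simp add: a_def)
    ultimately show ?thesis by (simp flip: abs_sgn)
  qed
  show ?thesis
  proof (rule that[of a])
    \<comment> \<open>If \<open>B = 0\<close> the quotient is 0 instead of 1, as division by zero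
      gives 0; it is at most 1 in both cases.\<close>
    have "(\<Sum>i<n. \<bar>a i\<bar> powr q) = B powr p / B powr p"
      by (simp add: ab BP flip: sum_divide_distrib)
    then have "(\<Sum>i<n. \<bar>a i\<bar> powr q) \<le> 1" by simp
    then show "ell_norm (conj_exp p) n a \<le> 1"
      using False q ell_norm_le_one_iff[of q n a] by (simp add: conj_exp_def q_def)
    have "(\<Sum>i<n. a i * b i) = B powr p / B powr (p - 1)"
      by (simp add: abi BP flip: sum_divide_distrib)
    also have "\<dots> = B"
      using B0 by (cases "B = 0") (simp_all add: powr_diff)
    finally show "(\<Sum>i<n. a i * b i) = ell_norm (ereal p) n b"
      by (simp add: B_def)
  qed
qed

text \<open>Minkowski by duality: a sequence norming \<open>b + d\<close> is tested against
  \<open>b\<close> and \<open>d\<close> separately.\<close>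

lemma ell_norm_triangle:
  assumes "1 \<le> p"
  shows "ell_norm (ereal p) n (\<lambda>i. b i + d i) \<le> ell_norm (ereal p) n b + ell_norm (ereal p) n d"
proof -
  obtain a where a: "ell_norm (conj_exp p) n a \<le> 1"
    "(\<Sum>i<n. a i * (b i + d i)) = ell_norm (ereal p) n (\<lambda>i. b i + d i)"
    using holder_attained[OF assms, of n "\<lambda>i. b i + d i"] by blast
  then show ?thesis
    using holder_le_one[OF assms a(1), of b] holder_le_one[OF assms a(1), of d]
    by (simp add: distrib_left sum.distrib)
qed

lemma ell_norm_sum_le:
  assumes "1 \<le> p" and "finite A"
  shows "ell_norm (ereal p) n (\<lambda>i. \<Sum>x\<in>A. b x i) \<le> (\<Sum>x\<in>A. ell_norm (ereal p) n (b x))"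
  using assms(2)
proof induction
  case empty
  then show ?case by (simp add: ell_norm_ereal)
next
  case (insert x A)
  then show ?case
    using ell_norm_triangle[OF assms(1), of n "b x" "\<lambda>i. \<Sum>x\<in>A. b x i"] by simp
qed

text \<open>The supremum in \<open>weak_norm\<close> is taken in the reals, so it is meaningful only
  with an upper bound. Coefficients of conjugate norm at most 1 have absolute value at most 1, which
  gives a crude one.\<close>

lemma bdd_above_weak_norm:
  fixes z :: "nat \<Rightarrow> 'a::real_normed_vector"
  assumes "1 \<le> p"
  shows "bdd_above ((\<lambda>a. norm (\<Sum>i<n. a i *\<^sub>R z i)) ` {a. ell_norm (conj_exp p) n a \<le> 1})"
proof (rule bdd_aboveI2)
  fix a assume "a \<in> {a. ell_norm (conj_exp p) n a \<le> 1}"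
  then have "\<bar>a i\<bar> \<le> 1" if "i < n" for i
    using abs_le_ell_norm[OF conj_exp_pos[OF assms] that, of a] by simp
  then show "norm (\<Sum>i<n. a i *\<^sub>R z i) \<le> (\<Sum>i<n. norm (z i))"
    by (intro sum_norm_le) (auto intro: mult_left_le_one_le)
qed

lemma norm_sum_le_weak_norm:
  assumes "1 \<le> p" and "ell_norm (conj_exp p) n a \<le> 1"
  shows "norm (\<Sum>i<n. a i *\<^sub>R z i) \<le> weak_norm p n z"
  unfolding weak_norm_def
  using assms by (intro cSUP_upper bdd_above_weak_norm) auto

lemma ell_norm_zero: "ell_norm q n (\<lambda>_. 0) = 0"
  by (auto simp: ell_norm_def image_constant_conv)

lemma weak_norm_nonneg:
  assumes "1 \<le> p"
  shows "0 \<le> weak_norm p n z"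
  using norm_sum_le_weak_norm[OF assms, of n "\<lambda>_. 0" z] by (simp add: ell_norm_zero)

lemma weak_norm_le:
  assumes "\<And>a. ell_norm (conj_exp p) n a \<le> 1 \<Longrightarrow> norm (\<Sum>i<n. a i *\<^sub>R z i) \<le> C"
  shows "weak_norm p n z \<le> C"
  unfolding weak_norm_def
proof (rule cSUP_least)
  have "(\<lambda>_. 0) \<in> {a. ell_norm (conj_exp p) n a \<le> 1}" by (simp add: ell_norm_zero)
  then show "{a. ell_norm (conj_exp p) n a \<le> 1} \<noteq> {}" by blast
qed (use assms in auto)

text \<open>The components along the fixed vector \<open>z\<close> add up to the scalar \<Sum>
  \<open>a i * t i\<close>, which Hoelder bounds by the p-norm of \<open>t\<close>. Thus a perturbed
  family costs no more than its two parts.\<close>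

lemma weak_norm_add_scale_le:
  assumes "1 \<le> p" and "0 \<le> r"
  shows "weak_norm p n (\<lambda>i. t i *\<^sub>R z + r *\<^sub>R w i) \<le> ell_norm (ereal p) n t * norm z + r * weak_norm p n w"
proof (rule weak_norm_le)
  fix a assume a: "ell_norm (conj_exp p) n a \<le> 1"
  have "norm (\<Sum>i<n. a i *\<^sub>R (t i *\<^sub>R z + r *\<^sub>R w i)) =
      norm ((\<Sum>i<n. a i * t i) *\<^sub>R z + r *\<^sub>R (\<Sum>i<n. a i *\<^sub>R w i))"
    by (simp add: scaleR_add_right sum.distrib scaleR_sum_left scaleR_sum_right mult.commute)
  also have "\<dots> \<le> \<bar>\<Sum>i<n. a i * t i\<bar> * norm z + r * norm (\<Sum>i<n. a i *\<^sub>R w i)"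
    using assms(2) by (intro order.trans[OF norm_triangle_ineq]) simp
  also have "\<dots> \<le> ell_norm (ereal p) n t * norm z + r * weak_norm p n w"
    by (intro add_mono mult_right_mono mult_left_mono holder_le_one norm_sum_le_weak_norm assms a norm_ge_zero)
  finally show "norm (\<Sum>i<n. a i *\<^sub>R (t i *\<^sub>R z + r *\<^sub>R w i)) \<le>
      ell_norm (ereal p) n t * norm z + r * weak_norm p n w" .
qed

text \<open>A norming sequence turns the p-norm of the values into the value at \<open>x\<close> of
  the single functional \<Sum> \<open>a i *\<^sub>R w i\<close>, whose norm is at most the weak
  norm. This is the estimate of the norm of \<open>delta x\<close> by that of
  \<open>x\<close>.\<close>

lemma ell_norm_eval_le:
  fixes w :: "nat \<Rightarrow> 'x::real_normed_vector dual"
  assumes "1 \<le> p"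
  shows "ell_norm (ereal p) n (\<lambda>i. blinfun_apply (w i) x) \<le> norm x * weak_norm p n w"
proof -
  obtain a where a: "ell_norm (conj_exp p) n a \<le> 1"
    "(\<Sum>i<n. a i * blinfun_apply (w i) x) = ell_norm (ereal p) n (\<lambda>i. blinfun_apply (w i) x)"
    using holder_attained[OF assms, of n "\<lambda>i. blinfun_apply (w i) x"] by blast
  have "(\<Sum>i<n. a i * blinfun_apply (w i) x) = blinfun_apply (\<Sum>i<n. a i *\<^sub>R w i) x"
    by (simp add: blinfun.sum_left blinfun.scaleR_left)
  also have "\<dots> \<le> norm (\<Sum>i<n. a i *\<^sub>R w i) * norm x"
    using norm_blinfun[of "\<Sum>i<n. a i *\<^sub>R w i" x] by simp
  also have "\<dots> \<le> weak_norm p n w * norm x"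
    by (intro mult_right_mono norm_sum_le_weak_norm assms a norm_ge_zero)
  finally show ?thesis using a(2) by (simp add: mult.commute)
qed

section \<open>The norms \<open>Hnorm\<close> and \<open>pi_norm_on\<close> tested on finite
  families\<close>

lemma Hnorm_le:
  assumes "0 \<le> C"
    and "\<And>n \<phi>. ell_norm (ereal p) n (\<lambda>i. f (\<phi> i)) \<le> C * weak_norm p n \<phi>"
  shows "Hnorm p f \<le> ennreal C"
  unfolding Hnorm_def
  using assms by (intro INF_lower) (simp add: ell_norm_ereal)

lemma ell_norm_le_of_Hnorm_less:
  assumes "1 \<le> p" and "Hnorm p f < ennreal \<epsilon>"
  shows "ell_norm (ereal p) n (\<lambda>i. f (\<phi> i)) \<le> \<epsilon> * weak_norm p n \<phi>"
proof -
  obtain C where C: "0 \<le> C" "ennreal C < ennreal \<epsilon>"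
    "\<And>n \<phi>. ell_norm (ereal p) n (\<lambda>i. f (\<phi> i)) \<le> C * weak_norm p n \<phi>"
    using assms(2) unfolding Hnorm_def INF_less_iff by (auto simp: ell_norm_ereal)
  then have "C \<le> \<epsilon>" by (simp add: ennreal_less_iff)
  then have "C * weak_norm p n \<phi> \<le> \<epsilon> * weak_norm p n \<phi>"
    using weak_norm_nonneg[OF assms(1)] by (rule mult_right_mono)
  then show ?thesis using C(3)[of n \<phi>] by linarith
qed

text \<open>One-term families already give a pointwise bound: their weak norm is at most the norm of
  the single functional.\<close>

lemma abs_le_of_Hnorm_less:
  assumes "1 \<le> p" and "Hnorm p f < ennreal \<epsilon>"
  shows "\<bar>f \<phi>\<bar> \<le> \<epsilon> * norm \<phi>"
proof -
  have "0 < \<epsilon>" using assms(2) ennreal_neg[of \<epsilon>] by (cases "0 < \<epsilon>") auto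
  have "\<bar>f \<phi>\<bar> = ell_norm (ereal p) 1 (\<lambda>_. f \<phi>)"
    using assms(1) by (simp add: ell_norm_ereal powr_powr)
  also have "\<dots> \<le> \<epsilon> * weak_norm p 1 (\<lambda>_. \<phi>)"
    by (rule ell_norm_le_of_Hnorm_less[OF assms])
  also have "weak_norm p 1 (\<lambda>_. \<phi>) \<le> norm \<phi>"
    using weak_norm_add_scale_le[OF assms(1), of 0 1 "\<lambda>_. 1" \<phi> "\<lambda>_. 0"]
    by (simp add: ell_norm_ereal)
  finally show ?thesis using \<open>0 < \<epsilon>\<close> by simp
qed

text \<open>A finite infimum has an admissible constant; \<open>C\<close> is any one of
  them.\<close>

lemma pi_norm_on_finite:
  fixes S :: "'a::real_normed_vector \<Rightarrow>\<^sub>L 'b::real_normed_vector"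
  assumes "pi_norm_on p W S < \<infinity>"
  obtains C where "0 \<le> C"
    "\<And>(n::nat) z. (\<And>i. i < n \<Longrightarrow> z i \<in> W) \<Longrightarrow>
      ell_norm (ereal p) n (\<lambda>i. norm (blinfun_apply S (z i))) \<le> C * weak_norm p n z"
  using assms unfolding pi_norm_on_def INF_less_iff by (auto simp: ell_norm_ereal)

text \<open>If no family violated the inequality, \<open>c\<close> would be an admissible constant
  and the infimum at most \<open>c\<close>. This is how persistence yields concrete families of
  functionals.\<close>

lemma pi_norm_on_greater:
  fixes S :: "'a::real_normed_vector \<Rightarrow>\<^sub>L 'b::real_normed_vector"
  assumes "0 \<le> c" and "ennreal c < pi_norm_on p W S"
  obtains n :: nat and z :: "nat \<Rightarrow> 'a" where "\<And>i. i < n \<Longrightarrow> z i \<in> W"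
    "c * weak_norm p n z < ell_norm (ereal p) n (\<lambda>i. norm (blinfun_apply S (z i)))"
proof (rule ccontr)
  assume neg: "\<not> thesis"
  have "pi_norm_on p W S \<le> ennreal c"
    unfolding pi_norm_on_def
  proof (rule INF_lower, safe)
    fix n :: nat and z :: "nat \<Rightarrow> 'a" assume "\<forall>i<n. z i \<in> W"
    then show "(\<Sum>i<n. norm (blinfun_apply S (z i)) powr p) powr (1 / p) \<le> c * weak_norm p n z"
      using neg that[of n z] by (force simp: ell_norm_ereal)
  qed (fact assms(1))
  then show False using assms(2) by simp
qed

subsection \<open>Sublattices and ideals of \<open>H\<^bsub>w*\<^esub>[X]\<close>\<close>

lemma delta_in_Hw: "delta x \<in> Hw"
  unfolding Hw_def delta_def
  by (auto simp: blinfun.scaleR_left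
      intro: continuous_map_from_subtopology strong_operator_topology_continuous_evaluation)

lemma fun_subspace_Hw: "fun_subspace Hw"
  unfolding fun_subspace_def Hw_def
  by (auto simp: distrib_left intro!: continuous_map_add continuous_map_real_mult_left)

lemma vector_sublattice_of_Hw: "vector_sublattice_of Hw Hw"
  using fun_subspace_Hw unfolding vector_sublattice_of_def
  by (auto simp: Hw_def max_mult_distrib_left min_mult_distrib_left
      intro!: continuous_map_real_max continuous_map_real_min)

lemma order_ideal_of_Hw: "order_ideal_of Hw Hw"
  using fun_subspace_Hw by (auto simp: order_ideal_of_def)

lemma FVL_sublattice: "vector_sublattice_of Hw FVL"
proof -
  have "FVL \<subseteq> Hw"
    unfolding FVL_def by (intro hull_minimal vector_sublattice_of_Hw) (auto intro: delta_in_Hw)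
  then show ?thesis
    by (simp add: FVL_def hull_def vector_sublattice_of_def fun_subspace_def)
qed

lemma Iw_ideal: "order_ideal_of Hw Iw"
  unfolding order_ideal_of_def
proof (intro conjI ballI impI)
  show "Iw \<subseteq> Hw"
    unfolding Iw_def by (intro hull_minimal order_ideal_of_Hw) (auto intro: delta_in_Hw)
  show "fun_subspace Iw"
    by (simp add: Iw_def hull_def order_ideal_of_def fun_subspace_def)
  fix f g :: "'a dual \<Rightarrow> real"
  assume f: "f \<in> Iw" and g: "g \<in> Hw" "\<forall>x. \<bar>g x\<bar> \<le> \<bar>f x\<bar>"
  have "g \<in> S" if S: "order_ideal_of Hw S" "range delta \<subseteq> S" for S
  proof -
    have "f \<in> S" using f S by (simp add: Iw_def hull_def)
    then show ?thesis using S(1) g by (simp add: order_ideal_of_def)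
  qed
  then show "g \<in> Iw" by (simp add: Iw_def hull_def)
qed

lemma vector_sublattice_scale:
  assumes "vector_sublattice_of H S" and "f \<in> S"
  shows "(\<lambda>x. c * f x) \<in> S"
  using assms by (simp add: vector_sublattice_of_def fun_subspace_def)

lemma vector_sublattice_max:
  assumes "vector_sublattice_of H S" and "f \<in> S" and "g \<in> S"
  shows "(\<lambda>x. max (f x) (g x)) \<in> S"
  using assms by (simp add: vector_sublattice_of_def)

lemma vector_sublattice_min:
  assumes "vector_sublattice_of H S" and "f \<in> S" and "g \<in> S"
  shows "(\<lambda>x. min (f x) (g x)) \<in> S"
  using assms by (simp add: vector_sublattice_of_def)

lemma vector_sublattice_abs:
  assumes "vector_sublattice_of H S" and "f \<in> S"
  shows "(\<lambda>x. \<bar>f x\<bar>) \<in> S"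
proof -
  have "(\<lambda>x. max (f x) (-1 * f x)) \<in> S"
    by (intro vector_sublattice_max[OF assms] vector_sublattice_scale[OF assms])
  moreover have "(\<lambda>x. max (f x) (-1 * f x)) = (\<lambda>x. \<bar>f x\<bar>)"
    by (auto simp: fun_eq_iff max_def)
  ultimately show ?thesis by simp
qed

text \<open>Both max and min are dominated by \<open>\<bar>f x\<bar> + \<bar>g x\<bar>\<close>,
  which lies in the ideal. Hence sets of ideal elements can be directed by maxima.\<close>

lemma order_ideal_sublattice:
  assumes H: "vector_sublattice_of H H" and I: "order_ideal_of H I"
  shows "vector_sublattice_of H I"
  unfolding vector_sublattice_of_def
proof (intro conjI ballI)
  show IH: "I \<subseteq> H" and "fun_subspace I"
    using I by (auto simp: order_ideal_of_def)
  fix f g assume fg: "f \<in> I" "g \<in> I"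
  then have HH: "f \<in> H" "g \<in> H" using IH by auto
  have solid: "k \<in> I" if "l \<in> I" "k \<in> H" "\<And>x. \<bar>k x\<bar> \<le> \<bar>l x\<bar>" for k l
    using I that by (simp add: order_ideal_of_def)
  have abs: "(\<lambda>x. \<bar>k x\<bar>) \<in> I" if "k \<in> I" for k
    by (rule solid[OF that vector_sublattice_abs[OF H subsetD[OF IH that]]]) simp
  have s: "(\<lambda>x. \<bar>f x\<bar> + \<bar>g x\<bar>) \<in> I"
    using abs[OF fg(1)] abs[OF fg(2)] I by (simp add: order_ideal_of_def fun_subspace_def)
  show "(\<lambda>x. max (f x) (g x)) \<in> I"
    by (rule solid[OF s vector_sublattice_max[OF H HH]]) auto
  show "(\<lambda>x. min (f x) (g x)) \<in> I"
    by (rule solid[OF s vector_sublattice_min[OF H HH]]) auto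
qed

section \<open>Control by finitely many evaluations\<close>

lemma sum_union_bound:
  fixes b :: "'a \<Rightarrow> real"
  assumes "finite A" "finite B" "\<And>x. 0 \<le> b x" "0 \<le> C" "0 \<le> D"
  shows "C * (\<Sum>x\<in>A. b x) + D * (\<Sum>x\<in>B. b x) \<le> (C + D) * (\<Sum>x\<in>A \<union> B. b x)"
proof -
  have "(\<Sum>x\<in>A. b x) \<le> (\<Sum>x\<in>A \<union> B. b x)" "(\<Sum>x\<in>B. b x) \<le> (\<Sum>x\<in>A \<union> B. b x)"
    by (rule sum_mono2; simp add: assms)+
  then show ?thesis
    unfolding distrib_right by (intro add_mono mult_left_mono assms)
qed

text \<open>The functions in \<open>Hw\<close> whose increments are controlled by finitely many
  evaluations form a vector sublattice containing every \<open>delta x\<close>, and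
  \<open>FVL\<close> is the least such sublattice. Increments matter because \<open>g\<close> is
  later compared at \<open>t i *\<^sub>R \<phi> + \<mu> *\<^sub>R w i\<close> and
  \<open>t i *\<^sub>R \<phi>\<close>.\<close>

lemma FVL_lipschitz:
  fixes g :: "'x::real_normed_vector dual \<Rightarrow> real"
  assumes "g \<in> FVL"
  shows "\<exists>A C. finite A \<and> 0 \<le> C \<and>
    (\<forall>\<phi> \<psi>. \<bar>g \<phi> - g \<psi>\<bar> \<le> C * (\<Sum>x\<in>A. \<bar>blinfun_apply (\<phi> - \<psi>) x\<bar>))"
proof -
  define L where "L A C g \<longleftrightarrow> finite A \<and> 0 \<le> C \<and>
    (\<forall>\<phi> \<psi>. \<bar>g \<phi> - g \<psi>\<bar> \<le> C * (\<Sum>x\<in>A. \<bar>blinfun_apply (\<phi> - \<psi>) x\<bar>))"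
    for A :: "'x set" and C and g :: "'x dual \<Rightarrow> real"
  define S where "S = {g \<in> Hw. \<exists>A C. L A C g}"
  \<comment> \<open>Sum, max and min all satisfy the hypothesis on \<open>k\<close>, so one
    computation serves the three operations.\<close>
  have L_comb: "L (A \<union> B) (C + D) k"
    if f: "L A C f" and g: "L B D g"
      and k: "\<And>\<phi> \<psi>. \<bar>k \<phi> - k \<psi>\<bar> \<le> \<bar>f \<phi> - f \<psi>\<bar> + \<bar>g \<phi> - g \<psi>\<bar>" for A B C D f g k
    unfolding L_def
  proof (intro conjI allI)
    fix \<phi> \<psi>
    have "\<bar>k \<phi> - k \<psi>\<bar> \<le> C * (\<Sum>x\<in>A. \<bar>blinfun_apply (\<phi> - \<psi>) x\<bar>) +
        D * (\<Sum>x\<in>B. \<bar>blinfun_apply (\<phi> - \<psi>) x\<bar>)"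
      using f g by (intro order.trans[OF k] add_mono) (auto simp: L_def)
    also have "\<dots> \<le> (C + D) * (\<Sum>x\<in>A \<union> B. \<bar>blinfun_apply (\<phi> - \<psi>) x\<bar>)"
      using f g by (intro sum_union_bound) (auto simp: L_def)
    finally show "\<bar>k \<phi> - k \<psi>\<bar> \<le> (C + D) * (\<Sum>x\<in>A \<union> B. \<bar>blinfun_apply (\<phi> - \<psi>) x\<bar>)" .
  qed (use f g in \<open>auto simp: L_def\<close>)
  have L_scale: "L A (\<bar>c\<bar> * C) (\<lambda>x. c * f x)" if "L A C f" for A C f c
    using that unfolding L_def
    by (simp add: abs_mult mult_left_mono mult.assoc flip: right_diff_distrib)
  have "vector_sublattice_of Hw S"
    unfolding vector_sublattice_of_def fun_subspace_def
  proof (intro conjI ballI allI)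
    show "S \<subseteq> Hw" by (auto simp: S_def)
    have "L {} 0 (\<lambda>_. 0)" by (simp add: L_def)
    then show "(\<lambda>_. 0) \<in> S" using fun_subspace_Hw by (auto simp: S_def fun_subspace_def)
    fix f c assume "f \<in> S"
    then show "(\<lambda>x. c * f x) \<in> S"
      using fun_subspace_Hw L_scale unfolding S_def fun_subspace_def by blast
  next
    fix f g assume fg: "f \<in> S" "g \<in> S"
    then have H: "(\<lambda>x. f x + g x) \<in> Hw" "(\<lambda>x. max (f x) (g x)) \<in> Hw" "(\<lambda>x. min (f x) (g x)) \<in> Hw"
      using vector_sublattice_of_Hw unfolding S_def vector_sublattice_of_def fun_subspace_def
      by blast+
    obtain A B C D where AB: "L A C f" "L B D g" using fg by (auto simp: S_def)
    have "L (A \<union> B) (C + D) (\<lambda>x. f x + g x)" "L (A \<union> B) (C + D) (\<lambda>x. max (f x) (g x))"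
      "L (A \<union> B) (C + D) (\<lambda>x. min (f x) (g x))"
      by (rule L_comb[OF AB]; auto)+
    then show "(\<lambda>x. f x + g x) \<in> S" "(\<lambda>x. max (f x) (g x)) \<in> S" "(\<lambda>x. min (f x) (g x)) \<in> S"
      using H unfolding S_def by blast+
  qed
  moreover have "range delta \<subseteq> S"
  proof safe
    fix x :: 'x
    have "L {x} 1 (delta x)" by (simp add: L_def delta_def blinfun.diff_left)
    then show "delta x \<in> S" using delta_in_Hw by (auto simp: S_def)
  qed
  ultimately have "FVL \<subseteq> S"
    unfolding FVL_def by (intro hull_minimal)
  then show ?thesis using assms by (auto simp: S_def L_def)
qed

text \<open>Minimality again, now of the ideal. Only growth is controlled: such a bound passes to
  every function of smaller absolute value, whereas a bound on increments in general does
  not.\<close>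

lemma Iw_dominated:
  fixes g :: "'x::real_normed_vector dual \<Rightarrow> real"
  assumes "g \<in> Iw"
  shows "\<exists>A C. finite A \<and> 0 \<le> C \<and> (\<forall>\<phi>. \<bar>g \<phi>\<bar> \<le> C * (\<Sum>x\<in>A. \<bar>blinfun_apply \<phi> x\<bar>))"
proof -
  define L where "L A C g \<longleftrightarrow> finite A \<and> 0 \<le> C \<and>
    (\<forall>\<phi>. \<bar>g \<phi>\<bar> \<le> C * (\<Sum>x\<in>A. \<bar>blinfun_apply \<phi> x\<bar>))"
    for A :: "'x set" and C and g :: "'x dual \<Rightarrow> real"
  define S where "S = {g \<in> Hw. \<exists>A C. L A C g}"
  have L_add: "L (A \<union> B) (C + D) (\<lambda>x. f x + g x)"
    if f: "L A C f" and g: "L B D g" for A B C D f g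
    unfolding L_def
  proof (intro conjI allI)
    fix \<phi>
    have "\<bar>f \<phi> + g \<phi>\<bar> \<le> C * (\<Sum>x\<in>A. \<bar>blinfun_apply \<phi> x\<bar>) + D * (\<Sum>x\<in>B. \<bar>blinfun_apply \<phi> x\<bar>)"
      using f g by (intro order.trans[OF abs_triangle_ineq] add_mono) (auto simp: L_def)
    also have "\<dots> \<le> (C + D) * (\<Sum>x\<in>A \<union> B. \<bar>blinfun_apply \<phi> x\<bar>)"
      using f g by (intro sum_union_bound) (auto simp: L_def)
    finally show "\<bar>f \<phi> + g \<phi>\<bar> \<le> (C + D) * (\<Sum>x\<in>A \<union> B. \<bar>blinfun_apply \<phi> x\<bar>)" .
  qed (use f g in \<open>auto simp: L_def\<close>)
  have L_scale: "L A (\<bar>c\<bar> * C) (\<lambda>x. c * f x)" if "L A C f" for A C f c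
    using that unfolding L_def
    by (simp add: abs_mult mult_left_mono mult.assoc)
  have L_dom: "L A C g" if "L A C f" "\<forall>x. \<bar>g x\<bar> \<le> \<bar>f x\<bar>" for A C f g
    using that unfolding L_def by (meson order.trans)
  have "order_ideal_of Hw S"
    unfolding order_ideal_of_def fun_subspace_def
  proof (intro conjI ballI allI impI)
    show "S \<subseteq> Hw" by (auto simp: S_def)
    have "L {} 0 (\<lambda>_. 0)" by (simp add: L_def)
    then show "(\<lambda>_. 0) \<in> S" using fun_subspace_Hw by (auto simp: S_def fun_subspace_def)
    fix f c assume "f \<in> S"
    then show "(\<lambda>x. c * f x) \<in> S"
      using fun_subspace_Hw L_scale unfolding S_def fun_subspace_def by blast
  next
    fix f g assume "f \<in> S" "g \<in> S"
    then show "(\<lambda>x. f x + g x) \<in> S"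
      using fun_subspace_Hw L_add unfolding S_def fun_subspace_def by blast
  next
    fix f g assume "f \<in> S" "g \<in> Hw" "\<forall>x. \<bar>g x\<bar> \<le> \<bar>f x\<bar>"
    then show "g \<in> S" using L_dom unfolding S_def by blast
  qed
  moreover have "range delta \<subseteq> S"
  proof safe
    fix x :: 'x
    have "L {x} 1 (delta x)" by (simp add: L_def delta_def)
    then show "delta x \<in> S" using delta_in_Hw by (auto simp: S_def)
  qed
  ultimately have "Iw \<subseteq> S"
    unfolding Iw_def by (intro hull_minimal)
  then show ?thesis using assms by (auto simp: S_def L_def)
qed

text \<open>Each \<open>x\<close> in \<open>A\<close> is replaced by a nearby \<open>r x\<close> in
  the dense set. Functionals annihilating \<open>r x\<close> take the same value at \<open>x\<close>
  as at the short vector \<open>x - r x\<close>, so \<open>ell_norm_eval_le\<close> makes these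
  values small.\<close>

lemma small_on_annihilator:
  fixes X0 :: "'x::real_normed_vector set"
  assumes p: "1 \<le> p" and X0: "closure X0 = UNIV" and "finite A" and "0 \<le> C" and "0 < \<eta>"
  obtains F where "finite F" "F \<subseteq> X0"
    "\<And>n w. (\<And>i. i < n \<Longrightarrow> w i \<in> (\<Inter>x\<in>F. annih x)) \<Longrightarrow>
      ell_norm (ereal p) n (\<lambda>i. C * (\<Sum>x\<in>A. \<bar>blinfun_apply (w i) x\<bar>)) \<le> \<eta> * weak_norm p n w"
proof -
  \<comment> \<open>Chosen so that \<open>C * card A * \<delta> \<le> \<eta>\<close>; the added ones
    keep the denominator positive for \<open>C = 0\<close> or empty \<open>A\<close>.\<close>
  define \<delta> where "\<delta> = \<eta> / ((C + 1) * (real (card A) + 1))"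
  have "0 < \<delta>" using assms by (simp add: \<delta>_def)
  then have "\<exists>y\<in>X0. norm (x - y) < \<delta>" for x
    using X0 closure_approachable[of x X0] by (auto simp: dist_norm norm_minus_commute)
  then obtain r where r: "\<And>x. r x \<in> X0" "\<And>x. norm (x - r x) < \<delta>" by metis
  show ?thesis
  proof (rule that[of "r ` A"])
    fix n :: nat and w :: "nat \<Rightarrow> 'x dual" assume w: "\<And>i. i < n \<Longrightarrow> w i \<in> (\<Inter>x\<in>r ` A. annih x)"
    have wn: "0 \<le> weak_norm p n w" using weak_norm_nonneg[OF p] .
    have "ell_norm (ereal p) n (\<lambda>i. C * (\<Sum>x\<in>A. \<bar>blinfun_apply (w i) x\<bar>)) \<le>
        ell_norm (ereal p) n (\<lambda>i. C * (\<Sum>x\<in>A. \<bar>blinfun_apply (w i) (x - r x)\<bar>))"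
    proof (rule ell_norm_mono)
      fix i assume "i < n"
      then have "blinfun_apply (w i) (x - r x) = blinfun_apply (w i) x" if "x \<in> A" for x
        using w that by (force simp: annih_def blinfun.diff_right)
      then show "\<bar>C * (\<Sum>x\<in>A. \<bar>blinfun_apply (w i) x\<bar>)\<bar> \<le>
          \<bar>C * (\<Sum>x\<in>A. \<bar>blinfun_apply (w i) (x - r x)\<bar>)\<bar>" by simp
    qed (use p in simp)
    also have "\<dots> = C * ell_norm (ereal p) n (\<lambda>i. \<Sum>x\<in>A. \<bar>blinfun_apply (w i) (x - r x)\<bar>)"
      using p \<open>0 \<le> C\<close> by (simp add: ell_norm_scale)
    also have "\<dots> \<le> C * (\<Sum>x\<in>A. ell_norm (ereal p) n (\<lambda>i. \<bar>blinfun_apply (w i) (x - r x)\<bar>))"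
      by (intro mult_left_mono ell_norm_sum_le assms)
    also have "\<dots> \<le> C * (\<Sum>x\<in>A. \<delta> * weak_norm p n w)"
    proof (intro mult_left_mono sum_mono \<open>0 \<le> C\<close>)
      fix x
      have "ell_norm (ereal p) n (\<lambda>i. \<bar>blinfun_apply (w i) (x - r x)\<bar>) =
          ell_norm (ereal p) n (\<lambda>i. blinfun_apply (w i) (x - r x))"
        by (simp add: ell_norm_ereal)
      also have "\<dots> \<le> norm (x - r x) * weak_norm p n w"
        by (rule ell_norm_eval_le[OF p])
      also have "\<dots> \<le> \<delta> * weak_norm p n w"
        using r(2)[of x] wn by (intro mult_right_mono) auto
      finally show "ell_norm (ereal p) n (\<lambda>i. \<bar>blinfun_apply (w i) (x - r x)\<bar>) \<le> \<delta> * weak_norm p n w" .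
    qed
    also have "\<dots> = C * real (card A) * \<delta> * weak_norm p n w" by simp
    also have "\<dots> \<le> \<eta> * weak_norm p n w"
    proof (rule mult_right_mono[OF _ wn])
      have "C * real (card A) * \<delta> \<le> (C + 1) * (real (card A) + 1) * \<delta>"
        using \<open>0 < \<delta>\<close> \<open>0 \<le> C\<close> by (intro mult_right_mono mult_mono) auto
      also have "\<dots> = \<eta>"
        using \<open>0 \<le> C\<close> by (simp add: \<delta>_def add_nonneg_eq_0_iff)
      finally show "C * real (card A) * \<delta> \<le> \<eta>" .
    qed
    finally show "ell_norm (ereal p) n (\<lambda>i. C * (\<Sum>x\<in>A. \<bar>blinfun_apply (w i) x\<bar>)) \<le>
        \<eta> * weak_norm p n w" .
  qed (use assms r in auto)
qed

subsection \<open>Dual persistent operators\<close>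

text \<open>Rescaling \<open>z\<close> to the unit sphere. The lemma turns common bounds for the
  functions \<open>\<bar>delta (T z)\<bar>\<close> into a bound for their supremum, the norm of the
  adjoint's value.\<close>

lemma norm_compose_le:
  fixes T :: "'z::real_normed_vector \<Rightarrow>\<^sub>L 'x::real_normed_vector" and \<phi> :: "'x dual"
  assumes "\<And>z. norm z \<le> 1 \<Longrightarrow> \<bar>blinfun_apply \<phi> (blinfun_apply T z)\<bar> \<le> b"
  shows "norm (\<phi> o\<^sub>L T) \<le> b"
proof (rule norm_blinfun_bound)
  show "0 \<le> b" using assms[of 0] by simp
  fix z
  show "norm (blinfun_apply (\<phi> o\<^sub>L T) z) \<le> b * norm z"
  proof (cases "z = 0")
    case False
    then have "\<bar>blinfun_apply \<phi> (blinfun_apply T (z /\<^sub>R norm z))\<bar> \<le> b"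
      by (intro assms) simp
    then show ?thesis
      using False by (simp add: blinfun.scaleR_right abs_mult field_simps)
  qed simp
qed

lemma Hw_pos_homogeneous: "f \<in> Hw \<Longrightarrow> 0 \<le> c \<Longrightarrow> f (c *\<^sub>R \<phi>) = c * f \<phi>"
  by (auto simp: Hw_def)

text \<open>Along a family \<open>w\<close> of functionals annihilating \<open>x\<close> and (almost) all vectors on which \<open>u\<close>
  depends, \<open>u\<close> does not distinguish \<open>t\<^sub>i \<phi> + \<mu> w\<^sub>i\<close> from \<open>t\<^sub>i \<phi>\<close>, while for \<open>t\<^sub>i = \<parallel>T\<^sup>* w\<^sub>i\<parallel>\<close> and
  large \<open>\<mu>\<close> the minimum at these points is the multiple \<open>t\<^sub>i N \<bar>\<phi> x\<bar>\<close>.\<close>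
lemma FBL_upper_bound_min:
  fixes T :: "'z::real_normed_vector \<Rightarrow>\<^sub>L 'x::real_normed_vector"
  assumes p: "1 \<le> p" and X0: "closure X0 = UNIV" and pers: "dual_persistent_rel p X0 T"
    and u: "u \<in> FBL p" and x: "x \<in> X0" and N: "0 \<le> N"
    and le: "\<And>\<phi>. min (norm (\<phi> o\<^sub>L T)) (N * \<bar>blinfun_apply \<phi> x\<bar>) \<le> u \<phi>"
  shows "N * \<bar>blinfun_apply \<phi> x\<bar> \<le> u \<phi>"
proof -
  obtain c where c: "0 < c" "\<And>F. finite F \<Longrightarrow> F \<subseteq> X0 \<Longrightarrow>
      ennreal c < pi_norm_on p (\<Inter>x\<in>F. annih x) (adjoint_op T)"
    using pers unfolding dual_persistent_rel_def by blast
  define h where "h \<phi> = N * \<bar>blinfun_apply \<phi> x\<bar>" for \<phi>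
  \<comment> \<open>With this value, \<open>\<mu> * t i - t i * norm (\<phi> o\<^sub>L T)\<close> is
    exactly \<open>t i * h \<phi>\<close>, so at \<open>\<psi> i\<close> the norm is no smaller than
    \<open>h\<close>.\<close>
  define \<mu> where "\<mu> = h \<phi> + norm (\<phi> o\<^sub>L T)"
  have "0 \<le> \<mu>" using N by (simp add: \<mu>_def h_def)
  \<comment> \<open>One \<open>norm \<phi>\<close> comes from the weak norm of
    \<open>\<psi>\<close>, the other from replacing \<open>u\<close> by \<open>g\<close> at
    \<open>\<phi>\<close>; the two terms \<open>\<mu> / c\<close> come from the errors
    \<open>d\<close> and \<open>e\<close>.\<close>
  define K where "K = 2 * norm \<phi> + 2 * \<mu> / c"
  have K: "0 \<le> K" using \<open>0 \<le> \<mu>\<close> c by (simp add: K_def)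
  have bound: "h \<phi> - u \<phi> \<le> \<epsilon> * K" if \<epsilon>: "0 < \<epsilon>" for \<epsilon>
  proof -
    obtain g where g: "g \<in> FVL" "Hnorm p (\<lambda>\<phi>. u \<phi> - g \<phi>) < ennreal \<epsilon>"
      using u \<epsilon> unfolding FBL_def Hwp_closure_def by blast
    obtain A C where A: "finite A" "0 \<le> C"
      "\<And>\<phi> \<psi>. \<bar>g \<phi> - g \<psi>\<bar> \<le> C * (\<Sum>x\<in>A. \<bar>blinfun_apply (\<phi> - \<psi>) x\<bar>)"
      using FVL_lipschitz[OF g(1)] by blast
    obtain F where F: "finite F" "F \<subseteq> X0"
      "\<And>n w. (\<And>i. i < n \<Longrightarrow> w i \<in> (\<Inter>x\<in>F. annih x)) \<Longrightarrow>
        ell_norm (ereal p) n (\<lambda>i. C * (\<Sum>x\<in>A. \<bar>blinfun_apply (w i) x\<bar>)) \<le> \<epsilon> * weak_norm p n w"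
      using small_on_annihilator[OF p X0 A(1,2) \<epsilon>] by blast
    \<comment> \<open>Annihilating \<open>x\<close> as well gives
      \<open>h (\<psi> i) = t i * h \<phi>\<close>.\<close>
    obtain n w where w: "\<And>i. i < n \<Longrightarrow> w i \<in> (\<Inter>x\<in>insert x F. annih x)"
      "c * weak_norm p n w < ell_norm (ereal p) n (\<lambda>i. norm (blinfun_apply (adjoint_op T) (w i)))"
    proof (rule pi_norm_on_greater)
      show "0 \<le> c" using c by simp
      show "ennreal c < pi_norm_on p (\<Inter>x\<in>insert x F. annih x) (adjoint_op T)"
        using F x by (intro c) auto
    qed blast
    define t where "t i = norm (w i o\<^sub>L T)" for i
    define \<tau> where "\<tau> = ell_norm (ereal p) n t"
    define \<psi> where "\<psi> i = t i *\<^sub>R \<phi> + \<mu> *\<^sub>R w i" for i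
    define d where "d i = u (\<psi> i) - g (\<psi> i)" for i
    define e where "e i = \<mu> * (C * (\<Sum>x\<in>A. \<bar>blinfun_apply (w i) x\<bar>))" for i
    have t0: "0 \<le> t i" for i by (simp add: t_def)
    have \<tau>: "c * weak_norm p n w < \<tau>"
      using w(2) by (simp add: \<tau>_def t_def [abs_def] adjoint_op_apply)
    have wn: "0 \<le> weak_norm p n w" using weak_norm_nonneg[OF p] .
    have "0 < \<tau>" using \<tau> c wn by (smt (verit) mult_nonneg_nonneg)
    \<comment> \<open>Every term of the final estimate now carries a factor \<open>\<tau>\<close>,
      which cancels because \<open>\<tau>\<close> is positive.\<close>
    have wn_le: "weak_norm p n w \<le> \<tau> / c" using \<tau> c by (simp add: field_simps)
    \<comment> \<open>\<open>d i\<close> is the error of \<open>g\<close> as an approximation of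
      \<open>u\<close> at \<open>\<psi> i\<close>, and \<open>e i\<close> bounds the effect on
      \<open>g\<close> of the perturbation by \<open>w i\<close>.\<close>
    have pointwise: "t i * (h \<phi> - g \<phi>) \<le> \<bar>d i\<bar> + e i" if "i < n" for i
    proof -
      have wx: "blinfun_apply (w i) x = 0" using w(1)[OF that] by (simp add: annih_def)
      have "\<psi> i o\<^sub>L T = t i *\<^sub>R (\<phi> o\<^sub>L T) + \<mu> *\<^sub>R (w i o\<^sub>L T)"
        by (rule blinfun_eqI)
          (simp add: \<psi>_def blinfun.add_left blinfun.scaleR_left)
      then have "norm (\<mu> *\<^sub>R (w i o\<^sub>L T)) - norm (t i *\<^sub>R (\<phi> o\<^sub>L T)) \<le> norm (\<psi> i o\<^sub>L T)"
        using norm_diff_ineq[of "\<mu> *\<^sub>R (w i o\<^sub>L T)" "t i *\<^sub>R (\<phi> o\<^sub>L T)"] by (simp add: add.commute)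
      then have "\<mu> * t i - t i * norm (\<phi> o\<^sub>L T) \<le> norm (\<psi> i o\<^sub>L T)"
        using \<open>0 \<le> \<mu>\<close> t0[of i] by (simp flip: t_def)
      then have "t i * h \<phi> \<le> norm (\<psi> i o\<^sub>L T)"
        by (simp add: \<mu>_def algebra_simps)
      moreover have "t i * h \<phi> = h (\<psi> i)"
        using t0[of i] by (simp add: h_def \<psi>_def blinfun.add_left blinfun.scaleR_left wx abs_mult)
      ultimately have "t i * h \<phi> \<le> u (\<psi> i)"
        using le[of "\<psi> i", folded h_def] by simp
      moreover have "g (t i *\<^sub>R \<phi>) = t i * g \<phi>"
        using g(1) FVL_sublattice t0[of i]
        by (intro Hw_pos_homogeneous) (auto simp: vector_sublattice_of_def)
      moreover have "\<bar>g (\<psi> i) - g (t i *\<^sub>R \<phi>)\<bar> \<le> e i"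
        using A(3)[of "\<psi> i" "t i *\<^sub>R \<phi>"] \<open>0 \<le> \<mu>\<close>
        by (simp add: e_def \<psi>_def blinfun.scaleR_left abs_mult sum_distrib_left mult_ac)
      ultimately show ?thesis
        unfolding d_def right_diff_distrib by linarith
    qed
    have "ell_norm (ereal p) n d \<le> \<epsilon> * weak_norm p n \<psi>"
      unfolding d_def by (rule ell_norm_le_of_Hnorm_less[OF p g(2)])
    also have "weak_norm p n \<psi> \<le> \<tau> * norm \<phi> + \<mu> * weak_norm p n w"
      unfolding \<psi>_def \<tau>_def by (rule weak_norm_add_scale_le[OF p \<open>0 \<le> \<mu>\<close>])
    finally have d: "ell_norm (ereal p) n d \<le> \<epsilon> * (\<tau> * norm \<phi> + \<mu> * weak_norm p n w)"
      using \<epsilon> by simp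
    have "ell_norm (ereal p) n e = \<mu> * ell_norm (ereal p) n (\<lambda>i. C * (\<Sum>x\<in>A. \<bar>blinfun_apply (w i) x\<bar>))"
      unfolding e_def using p \<open>0 \<le> \<mu>\<close> by (subst ell_norm_scale) auto
    also have "\<dots> \<le> \<mu> * (\<epsilon> * weak_norm p n w)"
      using w(1) by (intro mult_left_mono F(3) \<open>0 \<le> \<mu>\<close>) auto
    finally have e: "ell_norm (ereal p) n e \<le> \<mu> * (\<epsilon> * weak_norm p n w)" .
    \<comment> \<open>\<open>ell_norm_scale\<close> produces the absolute value of the factor, so
      the norm estimate is used only when it is nonnegative; otherwise the left side is at most
      0.\<close>
    have "\<tau> * (h \<phi> - g \<phi>) \<le> \<tau> * (\<epsilon> * (norm \<phi> + 2 * \<mu> / c))"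
    proof (cases "0 \<le> h \<phi> - g \<phi>")
      case True
      have "\<tau> * (h \<phi> - g \<phi>) = ell_norm (ereal p) n (\<lambda>i. (h \<phi> - g \<phi>) * t i)"
        using p True by (subst ell_norm_scale) (auto simp: \<tau>_def)
      also have "\<dots> \<le> ell_norm (ereal p) n (\<lambda>i. \<bar>d i\<bar> + e i)"
        using p True t0 pointwise
        by (intro ell_norm_mono) (auto simp: abs_mult mult.commute intro: order.trans[OF _ abs_ge_self])
      also have "\<dots> \<le> ell_norm (ereal p) n (\<lambda>i. \<bar>d i\<bar>) + ell_norm (ereal p) n e"
        by (rule ell_norm_triangle[OF p])
      also have "ell_norm (ereal p) n (\<lambda>i. \<bar>d i\<bar>) = ell_norm (ereal p) n d"
        by (simp add: ell_norm_ereal)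
      also have "\<dots> + ell_norm (ereal p) n e \<le> \<epsilon> * (\<tau> * norm \<phi> + 2 * \<mu> * weak_norm p n w)"
        using d e by (simp add: algebra_simps)
      also have "\<dots> \<le> \<epsilon> * (\<tau> * norm \<phi> + 2 * \<mu> * (\<tau> / c))"
        using \<epsilon> \<open>0 \<le> \<mu>\<close> wn_le by (intro mult_left_mono add_left_mono) auto
      also have "\<dots> = \<tau> * (\<epsilon> * (norm \<phi> + 2 * \<mu> / c))"
        by (simp add: algebra_simps)
      finally show ?thesis .
    next
      case False
      then have "\<tau> * (h \<phi> - g \<phi>) \<le> 0"
        using \<open>0 < \<tau>\<close> by (intro mult_nonneg_nonpos) auto
      also have "0 \<le> \<tau> * (\<epsilon> * (norm \<phi> + 2 * \<mu> / c))"
        using \<open>0 < \<tau>\<close> \<epsilon> \<open>0 \<le> \<mu>\<close> c by simp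
      finally show ?thesis .
    qed
    then have "h \<phi> - g \<phi> \<le> \<epsilon> * (norm \<phi> + 2 * \<mu> / c)"
      using \<open>0 < \<tau>\<close> by (simp only: mult_le_cancel_left_pos)
    moreover have "\<bar>u \<phi> - g \<phi>\<bar> \<le> \<epsilon> * norm \<phi>"
      by (rule abs_le_of_Hnorm_less[OF p g(2)])
    moreover have "\<epsilon> * K = \<epsilon> * (norm \<phi> + 2 * \<mu> / c) + \<epsilon> * norm \<phi>"
      by (simp add: K_def algebra_simps)
    ultimately show ?thesis
      by linarith
  qed
  have "h \<phi> \<le> u \<phi>"
  proof (rule field_le_epsilon)
    fix \<epsilon> :: real assume "0 < \<epsilon>"
    \<comment> \<open>\<open>K\<close> may be 0, hence the denominator \<open>K + 1\<close>.\<close>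
    then have "h \<phi> - u \<phi> \<le> \<epsilon> / (K + 1) * K"
      using K by (intro bound) auto
    also have "\<dots> \<le> \<epsilon>"
      using K \<open>0 < \<epsilon>\<close> by (simp add: field_simps)
    finally show "h \<phi> \<le> u \<phi> + \<epsilon>" by simp
  qed
  then show ?thesis by (simp add: h_def)
qed

text \<open>Approximate a dominating \<open>u\<close> by an ideal element \<open>g\<close> up to
  \<open>c / 2\<close>. On a suitable annihilator \<open>g\<close> has p-norm at most
  \<open>c / 2\<close> as well, so \<open>c\<close> would be a summing constant of the adjoint
  there, against persistence.\<close>

lemma Iw_closure_not_dominating:
  fixes T :: "'z::real_normed_vector \<Rightarrow>\<^sub>L 'x::real_normed_vector"
  assumes p: "1 \<le> p" and X0: "closure X0 = UNIV" and pers: "dual_persistent_rel p X0 T"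
    and u: "u \<in> Iw_closure p"
  obtains \<phi> where "u \<phi> < norm (\<phi> o\<^sub>L T)"
proof (rule ccontr)
  assume "\<not> thesis"
  then have le: "norm (\<phi> o\<^sub>L T) \<le> u \<phi>" for \<phi> using that[of \<phi>] by force
  obtain c where c: "0 < c" "\<And>F. finite F \<Longrightarrow> F \<subseteq> X0 \<Longrightarrow>
      ennreal c < pi_norm_on p (\<Inter>x\<in>F. annih x) (adjoint_op T)"
    using pers unfolding dual_persistent_rel_def by blast
  have c2: "0 < c / 2" using c by simp
  obtain g where g: "g \<in> Iw" "Hnorm p (\<lambda>\<phi>. u \<phi> - g \<phi>) < ennreal (c / 2)"
    using u c2 unfolding Iw_closure_def Hwp_closure_def by blast
  obtain A C where A: "finite A" "0 \<le> C" "\<And>\<phi>. \<bar>g \<phi>\<bar> \<le> C * (\<Sum>x\<in>A. \<bar>blinfun_apply \<phi> x\<bar>)"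
    using Iw_dominated[OF g(1)] by blast
  obtain F where F: "finite F" "F \<subseteq> X0"
    "\<And>n w. (\<And>i. i < n \<Longrightarrow> w i \<in> (\<Inter>x\<in>F. annih x)) \<Longrightarrow>
      ell_norm (ereal p) n (\<lambda>i. C * (\<Sum>x\<in>A. \<bar>blinfun_apply (w i) x\<bar>)) \<le> c / 2 * weak_norm p n w"
    using small_on_annihilator[OF p X0 A(1,2) c2] by blast
  obtain n w where w: "\<And>i. i < n \<Longrightarrow> w i \<in> (\<Inter>x\<in>F. annih x)"
    "c * weak_norm p n w < ell_norm (ereal p) n (\<lambda>i. norm (blinfun_apply (adjoint_op T) (w i)))"
    using pi_norm_on_greater[OF less_imp_le[OF c(1)] c(2)[OF F(1,2)]] by blast
  let ?d = "\<lambda>i. u (w i) - g (w i)" and ?e = "\<lambda>i. C * (\<Sum>x\<in>A. \<bar>blinfun_apply (w i) x\<bar>)"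
  have "ell_norm (ereal p) n (\<lambda>i. norm (blinfun_apply (adjoint_op T) (w i))) \<le>
      ell_norm (ereal p) n (\<lambda>i. \<bar>?d i\<bar> + ?e i)"
  proof (rule ell_norm_mono)
    fix i
    have "norm (w i o\<^sub>L T) \<le> \<bar>?d i\<bar> + ?e i"
      using le[of "w i"] A(3)[of "w i"] by linarith
    then show "\<bar>norm (blinfun_apply (adjoint_op T) (w i))\<bar> \<le> \<bar>\<bar>?d i\<bar> + ?e i\<bar>"
      by (simp add: adjoint_op_apply)
  qed (use p in simp)
  also have "\<dots> \<le> ell_norm (ereal p) n (\<lambda>i. \<bar>?d i\<bar>) + ell_norm (ereal p) n ?e"
    by (rule ell_norm_triangle[OF p])
  also have "ell_norm (ereal p) n (\<lambda>i. \<bar>?d i\<bar>) = ell_norm (ereal p) n ?d"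
    by (simp add: ell_norm_ereal)
  also have "ell_norm (ereal p) n ?d + ell_norm (ereal p) n ?e \<le> c * weak_norm p n w"
    using ell_norm_le_of_Hnorm_less[OF p g(2), of n w] F(3)[of n w] w(1) by force
  finally show False using w(2) by simp
qed

section \<open>Failure of the Fatou property and of monotone boundedness\<close>

lemma Hwp_subset_closure:
  assumes "1 \<le> p" and "f \<in> A" "f \<in> Hw" "Hnorm p f < \<infinity>"
  shows "f \<in> Hwp_closure p A"
proof -
  have "Hnorm p (\<lambda>\<phi>. f \<phi> - f \<phi>) \<le> ennreal 0"
    by (rule Hnorm_le) (simp_all add: ell_norm_zero)
  then have "Hnorm p (\<lambda>\<phi>. f \<phi> - f \<phi>) < ennreal \<epsilon>" if "0 < \<epsilon>" for \<epsilon>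
    using that by (simp add: order_le_less_trans)
  then show ?thesis
    using assms unfolding Hwp_closure_def Hwp_def by blast
qed

lemma Hnorm_abs_delta_le:
  assumes p: "1 \<le> p" and "0 \<le> N"
  shows "Hnorm p (\<lambda>\<phi>. N * \<bar>delta x \<phi>\<bar>) \<le> ennreal (N * norm x)"
proof (rule Hnorm_le)
  fix n :: nat and \<phi> :: "nat \<Rightarrow> 'a dual"
  have "ell_norm (ereal p) n (\<lambda>i. N * \<bar>delta x (\<phi> i)\<bar>) = N * ell_norm (ereal p) n (\<lambda>i. \<bar>delta x (\<phi> i)\<bar>)"
    using assms by (simp add: ell_norm_scale)
  also have "ell_norm (ereal p) n (\<lambda>i. \<bar>delta x (\<phi> i)\<bar>) = ell_norm (ereal p) n (\<lambda>i. blinfun_apply (\<phi> i) x)"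
    by (simp add: ell_norm_ereal delta_def)
  also have "N * \<dots> \<le> N * (norm x * weak_norm p n \<phi>)"
    by (intro mult_left_mono ell_norm_eval_le assms)
  finally show "ell_norm (ereal p) n (\<lambda>i. N * \<bar>delta x (\<phi> i)\<bar>) \<le> N * norm x * weak_norm p n \<phi>"
    by simp
qed (use assms in simp)

text \<open>Otherwise every functional vanishes on a dense set, the dual is zero, and no family can
  violate a summing inequality. The pair makes the norm of
  \<open>N * \<bar>delta x \<phi>\<bar>\<close> grow with \<open>N\<close>.\<close>

lemma dual_persistent_rel_nontrivial:
  fixes T :: "'z::real_normed_vector \<Rightarrow>\<^sub>L 'x::real_normed_vector"
  assumes p: "1 \<le> p" and X0: "closure X0 = UNIV" and pers: "dual_persistent_rel p X0 T"
  obtains x and \<phi> :: "'x dual" where "x \<in> X0" "blinfun_apply \<phi> x \<noteq> 0"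
proof (rule ccontr)
  assume neg: "\<not> thesis"
  have zero: "\<phi> = 0" for \<phi> :: "'x dual"
  proof (rule blinfun_eqI)
    fix y
    have "closure X0 \<subseteq> {x. blinfun_apply \<phi> x = 0}"
      using neg that by (intro closure_minimal closed_Collect_eq continuous_intros) auto
    then show "blinfun_apply \<phi> y = blinfun_apply 0 y" using X0 by auto
  qed
  obtain c where c: "0 < c" "\<And>F. finite F \<Longrightarrow> F \<subseteq> X0 \<Longrightarrow>
      ennreal c < pi_norm_on p (\<Inter>x\<in>F. annih x) (adjoint_op T)"
    using pers unfolding dual_persistent_rel_def by blast
  \<comment> \<open>The empty collection, whose common annihilator is the whole dual.\<close>
  have "ennreal c < pi_norm_on p (\<Inter>x\<in>{}. annih x) (adjoint_op T)"
    by (rule c(2)) auto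
  then obtain n and w :: "nat \<Rightarrow> 'x dual" where
    "c * weak_norm p n w < ell_norm (ereal p) n (\<lambda>i. norm (blinfun_apply (adjoint_op T) (w i)))"
    by (rule pi_norm_on_greater[OF less_imp_le[OF c(1)]])
  moreover have "(\<lambda>i. norm (blinfun_apply (adjoint_op T) (w i))) = (\<lambda>_. 0)"
    by (simp add: fun_eq_iff zero[where \<phi> = "w i" for i])
  ultimately show False
    using c weak_norm_nonneg[OF p, of n w]
    by (simp add: ell_norm_zero) (smt (verit) mult_nonneg_nonneg)
qed

text \<open>Any summing constant of the adjoint serves as \<open>K\<close>, by monotonicity of the
  p-norm. It is uniform in \<open>g\<close>, hence a common norm bound for the directed sets
  below.\<close>

lemma p_summing_dominates:
  fixes T :: "'z::real_normed_vector \<Rightarrow>\<^sub>L 'x::real_normed_vector"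
  assumes p: "1 \<le> p" and "p_summing p (adjoint_op T)"
  obtains K where "0 \<le> K"
    "\<And>g :: 'x dual \<Rightarrow> real. (\<And>\<phi>. \<bar>g \<phi>\<bar> \<le> norm (\<phi> o\<^sub>L T)) \<Longrightarrow> Hnorm p g \<le> ennreal K"
proof -
  obtain K where K: "0 \<le> K"
    "\<And>n z. ell_norm (ereal p) n (\<lambda>i. norm (blinfun_apply (adjoint_op T) (z i))) \<le> K * weak_norm p n z"
    using assms(2) pi_norm_on_finite[of p UNIV "adjoint_op T"] unfolding p_summing_def by auto
  show ?thesis
  proof (rule that[OF K(1)])
    fix g :: "'x dual \<Rightarrow> real" assume "\<And>\<phi>. \<bar>g \<phi>\<bar> \<le> norm (\<phi> o\<^sub>L T)"
    then have "ell_norm (ereal p) n (\<lambda>i. g (\<phi> i)) \<le>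
        ell_norm (ereal p) n (\<lambda>i. norm (blinfun_apply (adjoint_op T) (\<phi> i)))" for n \<phi>
      using p by (intro ell_norm_mono) (auto simp: adjoint_op_apply)
    then show "Hnorm p g \<le> ennreal K"
      using K(2) by (intro Hnorm_le K(1)) (rule order.trans)
  qed
qed

lemma abs_delta_le_norm_compose:
  fixes T :: "'z::real_normed_vector \<Rightarrow>\<^sub>L 'x::real_normed_vector"
  assumes "norm z \<le> 1"
  shows "\<bar>delta (blinfun_apply T z) \<phi>\<bar> \<le> norm (\<phi> o\<^sub>L T)"
proof -
  have "\<bar>delta (blinfun_apply T z) \<phi>\<bar> \<le> norm (\<phi> o\<^sub>L T) * norm z"
    using norm_blinfun[of "\<phi> o\<^sub>L T" z] by (simp add: delta_def)
  also have "\<dots> \<le> norm (\<phi> o\<^sub>L T)" using assms by (simp add: mult_left_le)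
  finally show ?thesis .
qed

text \<open>Pairwise maxima stay in \<open>S\<close> and below \<open>b\<close>, even when
  \<open>b\<close> itself is outside \<open>S\<close>; the zero function makes the set
  nonempty.\<close>

lemma directed_dominated:
  assumes "vector_sublattice_of H S" and "\<And>x. 0 \<le> b x"
  shows "directed_preorder {g \<in> S. \<forall>x. 0 \<le> g x \<and> g x \<le> b x} (\<le>)"
  unfolding directed_preorder_def
proof (intro conjI ballI impI)
  show "{g \<in> S. \<forall>x. 0 \<le> g x \<and> g x \<le> b x} \<noteq> {}"
    using assms by (auto simp: vector_sublattice_of_def fun_subspace_def)
next
  fix f g
  assume f: "f \<in> {g \<in> S. \<forall>x. 0 \<le> g x \<and> g x \<le> b x}" and g: "g \<in> {g \<in> S. \<forall>x. 0 \<le> g x \<and> g x \<le> b x}"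
  show "\<exists>k\<in>{g \<in> S. \<forall>x. 0 \<le> g x \<and> g x \<le> b x}. f \<le> k \<and> g \<le> k"
  proof (intro bexI[of _ "\<lambda>x. max (f x) (g x)"] CollectI conjI)
    show "(\<lambda>x. max (f x) (g x)) \<in> S"
      using f g by (intro vector_sublattice_max[OF assms(1)]) auto
  qed (use f g in \<open>auto simp: le_fun_def le_max_iff_disj\<close>)
qed auto

lemma FBL_not_fatou:
  fixes T :: "'z::real_normed_vector \<Rightarrow>\<^sub>L 'x::real_normed_vector"
  assumes p: "1 \<le> p" and X0: "closure X0 = UNIV" and pers: "dual_persistent_rel p X0 T"
    and sum: "p_summing p (adjoint_op T)" and "0 < \<kappa>"
  shows "\<not> fatou_property \<kappa> (FBL p :: ('x dual \<Rightarrow> real) set) (Hnorm p)"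
proof
  assume fatou: "fatou_property \<kappa> (FBL p :: ('x dual \<Rightarrow> real) set) (Hnorm p)"
  obtain K where K: "0 \<le> K"
    "\<And>g :: 'x dual \<Rightarrow> real. (\<And>\<phi>. \<bar>g \<phi>\<bar> \<le> norm (\<phi> o\<^sub>L T)) \<Longrightarrow> Hnorm p g \<le> ennreal K"
    using p_summing_dominates[OF p sum] by blast
  obtain x and \<phi>0 :: "'x dual" where x: "x \<in> X0" "blinfun_apply \<phi>0 x \<noteq> 0"
    using dual_persistent_rel_nontrivial[OF p X0 pers] by blast
  \<comment> \<open>\<open>K\<close> is independent of \<open>N\<close>, so \<open>N\<close> can be
    chosen afterwards: it makes \<open>h \<phi>0\<close> twice the value
    \<open>(\<kappa> * K + 1) * norm \<phi>0\<close> that the Fatou inequality would allow.\<close>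
  define N where "N = 2 * (\<kappa> * K + 1) * norm \<phi>0 / \<bar>blinfun_apply \<phi>0 x\<bar>"
  have "0 \<le> N" using K \<open>0 < \<kappa>\<close> by (simp add: N_def)
  define h where "h \<phi> = N * \<bar>delta x \<phi>\<bar>" for \<phi>
  have delta_FVL: "delta y \<in> FVL" for y :: 'x
    unfolding FVL_def by (simp add: hull_inc)
  have abs_FVL: "(\<lambda>\<phi>. \<bar>delta y \<phi>\<bar>) \<in> FVL" for y :: 'x
    by (rule vector_sublattice_abs[OF FVL_sublattice delta_FVL])
  have h_FVL: "h \<in> FVL"
    unfolding h_def [abs_def] by (rule vector_sublattice_scale[OF FVL_sublattice abs_FVL])
  have FVL_Hw: "FVL \<subseteq> (Hw :: ('x dual \<Rightarrow> real) set)"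
    using FVL_sublattice by (auto simp: vector_sublattice_of_def)
  have "Hnorm p h \<le> ennreal (N * norm x)"
    unfolding h_def by (rule Hnorm_abs_delta_le[OF p \<open>0 \<le> N\<close>])
  then have h_FBL: "h \<in> FBL p"
    unfolding FBL_def using h_FVL FVL_Hw p
    by (intro Hwp_subset_closure) (auto simp: order_le_less_trans)
  define b where "b \<phi> = min (norm (\<phi> o\<^sub>L T)) (h \<phi>)" for \<phi>
  \<comment> \<open>All minorants in \<open>FVL\<close> are taken, not only the functions
    \<open>min \<bar>delta (T z) \<phi>\<bar> (h \<phi>)\<close>, so that the set is
    directed.\<close>
  define S where "S = {g \<in> FVL. \<forall>\<phi>. 0 \<le> g \<phi> \<and> g \<phi> \<le> b \<phi>}"
  have h0: "0 \<le> h \<phi>" for \<phi> using \<open>0 \<le> N\<close> by (simp add: h_def)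
  have dir: "directed_preorder S (\<le>)"
    unfolding S_def using h0 by (intro directed_dominated[OF FVL_sublattice]) (simp add: b_def)
  have norm_S: "Hnorm p g \<le> ennreal K" if "g \<in> S" for g
    using that by (intro K(2)) (auto simp: S_def b_def)
  have pos: "S \<subseteq> positive_part (FBL p)"
  proof (intro subsetI)
    fix g assume g: "g \<in> S"
    have "Hnorm p g < \<infinity>" using norm_S[OF g] by (simp add: order_le_less_trans)
    then show "g \<in> positive_part (FBL p)"
      using g FVL_Hw p unfolding positive_part_def FBL_def
      by (auto simp: S_def intro!: Hwp_subset_closure)
  qed
  have "is_supremum_in (FBL p) S h"
    unfolding is_supremum_in_def
  proof (intro conjI ballI impI h_FBL)
    fix g assume "g \<in> S"
    then show "g \<le> h" by (simp add: S_def b_def le_fun_def)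
  next
    fix u assume u: "u \<in> FBL p" and ub: "\<forall>g\<in>S. g \<le> u"
    have min_le: "min \<bar>delta (blinfun_apply T z) \<phi>\<bar> (h \<phi>) \<le> u \<phi>" if "norm z \<le> 1" for z \<phi>
    proof -
      have "(\<lambda>\<phi>. min \<bar>delta (blinfun_apply T z) \<phi>\<bar> (h \<phi>)) \<in> FVL"
        by (rule vector_sublattice_min[OF FVL_sublattice abs_FVL h_FVL])
      then have "(\<lambda>\<phi>. min \<bar>delta (blinfun_apply T z) \<phi>\<bar> (h \<phi>)) \<in> S"
        using abs_delta_le_norm_compose[OF that] h0 unfolding S_def b_def
        by (auto intro: min.coboundedI1)
      then show ?thesis using ub by (auto simp: le_fun_def)
    qed
    \<comment> \<open>Where \<open>u\<close> lies below \<open>h\<close>, the minimum in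
      \<open>min_le\<close> has to be \<open>\<bar>delta (T z) \<phi>\<bar>\<close>; letting
      \<open>z\<close> run through the unit ball gives the norm.\<close>
    have "b \<phi> \<le> u \<phi>" for \<phi>
    proof (cases "h \<phi> \<le> u \<phi>")
      case False
      then have "norm (\<phi> o\<^sub>L T) \<le> u \<phi>"
        using min_le[of _ \<phi>] by (intro norm_compose_le) (force simp: delta_def min_le_iff_disj)
      then show ?thesis by (simp add: b_def)
    qed (simp add: b_def)
    \<comment> \<open>Membership of \<open>u\<close> in \<open>FBL p\<close> is decisive: it lifts
      the bound from the truncation \<open>b\<close> to all of \<open>h\<close>.\<close>
    then show "h \<le> u"
      using FBL_upper_bound_min[OF p X0 pers u x(1) \<open>0 \<le> N\<close>]
      by (auto simp: le_fun_def b_def h_def delta_def)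
  qed
  then have "Hnorm p h \<le> ennreal \<kappa> * (SUP g\<in>S. Hnorm p g)"
    using fatou dir pos by (simp add: fatou_property_def)
  also have "\<dots> \<le> ennreal \<kappa> * ennreal K"
    by (intro mult_left_mono SUP_least norm_S) auto
  \<comment> \<open>The added 1 gives the strict inequality required for the pointwise
    bound.\<close>
  also have "\<dots> < ennreal (\<kappa> * K + 1)"
    using K \<open>0 < \<kappa>\<close> by (simp add: ennreal_less_iff flip: ennreal_mult)
  finally have "\<bar>h \<phi>0\<bar> \<le> (\<kappa> * K + 1) * norm \<phi>0"
    by (rule abs_le_of_Hnorm_less[OF p])
  moreover have "0 < (\<kappa> * K + 1) * norm \<phi>0"
  proof (rule mult_pos_pos)
    show "0 < \<kappa> * K + 1" using K(1) \<open>0 < \<kappa>\<close> by (simp add: add_nonneg_pos)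
    show "0 < norm \<phi>0" using x(2) by auto
  qed
  moreover have "h \<phi>0 = 2 * ((\<kappa> * K + 1) * norm \<phi>0)"
    using x(2) by (simp add: h_def N_def delta_def)
  ultimately show False
    by linarith
qed

lemma Iw_closure_not_monotonically_bounded:
  fixes T :: "'z::real_normed_vector \<Rightarrow>\<^sub>L 'x::real_normed_vector"
  assumes p: "1 \<le> p" and X0: "closure X0 = UNIV" and pers: "dual_persistent_rel p X0 T"
    and sum: "p_summing p (adjoint_op T)"
  shows "\<not> monotonically_bounded (Iw_closure p :: ('x dual \<Rightarrow> real) set) (Hnorm p)"
proof
  assume mb: "monotonically_bounded (Iw_closure p :: ('x dual \<Rightarrow> real) set) (Hnorm p)"
  obtain K where K: "0 \<le> K"
    "\<And>g :: 'x dual \<Rightarrow> real. (\<And>\<phi>. \<bar>g \<phi>\<bar> \<le> norm (\<phi> o\<^sub>L T)) \<Longrightarrow> Hnorm p g \<le> ennreal K"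
    using p_summing_dominates[OF p sum] by blast
  have lat: "vector_sublattice_of Hw (Iw :: ('x dual \<Rightarrow> real) set)"
    by (rule order_ideal_sublattice[OF vector_sublattice_of_Hw Iw_ideal])
  then have Iw_Hw: "Iw \<subseteq> (Hw :: ('x dual \<Rightarrow> real) set)"
    by (auto simp: vector_sublattice_of_def)
  define S where "S = {g \<in> Iw. \<forall>\<phi>. 0 \<le> g \<phi> \<and> g \<phi> \<le> norm (\<phi> o\<^sub>L T)}"
  have dir: "directed_preorder S (\<le>)"
    unfolding S_def by (intro directed_dominated[OF lat]) simp
  have norm_S: "Hnorm p g \<le> ennreal K" if "g \<in> S" for g
    using that by (intro K(2)) (auto simp: S_def)
  have pos: "S \<subseteq> positive_part (Iw_closure p)"
  proof
    fix g assume g: "g \<in> S"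
    have "Hnorm p g < \<infinity>" using norm_S[OF g] by (simp add: order_le_less_trans)
    then show "g \<in> positive_part (Iw_closure p)"
      using g Iw_Hw p unfolding positive_part_def Iw_closure_def
      by (auto simp: S_def intro!: Hwp_subset_closure)
  qed
  \<comment> \<open>The directed set is used as a net indexed by itself through the
    identity.\<close>
  obtain u where u: "u \<in> Iw_closure p" "\<And>g. g \<in> S \<Longrightarrow> g \<le> u"
    using mb[unfolded monotonically_bounded_def, rule_format, of S "(\<le>)" "\<lambda>g. g"] dir pos norm_S
    by blast
  obtain \<phi> where \<phi>: "u \<phi> < norm (\<phi> o\<^sub>L T)"
    using Iw_closure_not_dominating[OF p X0 pers u(1)] by blast
  \<comment> \<open>The functions \<open>\<bar>delta (T z)\<bar>\<close> belong to the set, so an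
    upper bound dominates their supremum, against the choice of \<open>\<phi>\<close>.\<close>
  have "\<bar>blinfun_apply \<phi> (blinfun_apply T z)\<bar> \<le> u \<phi>" if "norm z \<le> 1" for z
  proof -
    have "delta (blinfun_apply T z) \<in> Iw"
      unfolding Iw_def by (simp add: hull_inc)
    then have "(\<lambda>\<phi>. \<bar>delta (blinfun_apply T z) \<phi>\<bar>) \<in> S"
      using vector_sublattice_abs[OF lat] abs_delta_le_norm_compose[OF that] by (auto simp: S_def)
    then show ?thesis using u(2) by (force simp: le_fun_def delta_def)
  qed
  then show False using norm_compose_le[of \<phi> T "u \<phi>"] \<phi> by force
qed

theorem theorem5p4:
  fixes p :: real and T :: "'z::banach \<Rightarrow>\<^sub>L 'x::banach"
  assumes "1 \<le> p"
    and "dual_persistent p T"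
    and "p_summing p (adjoint_op T)"
  shows "(\<forall>\<kappa>>0. \<not> fatou_property \<kappa> (FBL p :: ('x dual \<Rightarrow> real) set) (Hnorm p)) \<and>
         \<not> monotonically_bounded (Iw_closure p :: ('x dual \<Rightarrow> real) set) (Hnorm p)"
proof -
  obtain X0 where "closure X0 = UNIV" "dual_persistent_rel p X0 T"
    using assms(2) unfolding dual_persistent_def by blast
  then show ?thesis
    using FBL_not_fatou Iw_closure_not_monotonically_bounded assms(1,3) by blast
qed

end
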